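(* Let $T$ be a finite rooted tree (arbitrary fanouts and leaf depths allowed) with root $r$. Suppose the unknown true counts $(c_v)_{v\in T}$ are real numbers satisfying $c_v=\sum_{u\in\mathrm{child}(v)}c_u$ for every internal node $v$. Let $(x_v)_{v\in T}$ be independent random variables with $\mathbb{E}\,x_v=c_v$ and $\mathrm{Var}(x_v)=\mathsf{var}_v\in(0,\infty)$ (the $\mathsf{var}_v$ are known). Let $(\widehat{x}_v;\widehat{\mathsf{var}}_v)_{v\in T}$ be the output of the procedure $\mathsf{TreePostProcessing}$ (described in the context) on input $(x_v;\mathsf{var}_v)_{v\in T}$. Then for every $v\in T$, $\widehat{x}_v$ is the best linear unbiased estimator (BLUE) of $c_v$ and has variance $\widehat{\mathsf{var}}_v$. In particular, for every $\tau>0$ and every $v\in T$, $\widehat{x}_v$ minimizes $\mathrm{RMSRE}_\tau(c_v,\widehat{x}_v)$ among all linear unbiased estimators of $c_v$.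
   Context: For a node $v$, $\mathrm{child}(v)$ is its set of children and $\mathrm{parent}(v)$ its parent. A linear unbiased estimator of $c_v$ is an estimator that is a linear function of the observations $(x_u)_{u\in T}$ whose expectation equals $c_v$ for every choice of true counts satisfying the consistency relations above; it is BLUE if it has the smallest variance among all such estimators. For a count $c\ge 0$, an estimate $\hat c$, and threshold $\tau>0$, $\mathrm{RMSRE}_\tau(c,\hat c)=\sqrt{\mathbb{E}\big[(|\hat c-c|/\max(\tau,c))^2\big]}$. $\mathsf{CombineEstimates}((x;a),(y;b))$ returns $(z;s)$ with $s=\frac{ab}{a+b}$ and $z=s\left(\frac{x}{a}+\frac{y}{b}\right)$. $\mathsf{TreePostProcessing}$ on input $(x_v;\mathsf{var}_v)_{v\in T}$: Bottom-up pass: for each leaf $v$, set $(z^{\Uparrow}_v;\mathsf{var}^{\Uparrow}_v)=(x_v;\mathsf{var}_v)$. For each internal node $v$, in order from largest to smallest depth, set $(z^{\uparrow}_v;\mathsf{var}^{\uparrow}_v)=\big(\sum_{u\in\mathrm{child}(v)}z^{\Uparrow}_u;\sum_{u\in\mathrm{child}(v)}\mathsf{var}^{\Uparrow}_u\big)$ and $(z^{\Uparrow}_v;\mathsf{var}^{\Uparrow}_v)=\mathsf{CombineEstimates}((x_v;\mathsf{var}_v),(z^{\uparrow}_v;\mathsf{var}^{\uparrow}_v))$. Top-down pass: for the root set $(\widehat{x}_r;\widehat{\mathsf{var}}_r)=(z^{\Uparrow}_r;\mathsf{var}^{\Uparrow}_r)$ and $(z^{\Downarrow}_r;\mathsf{var}^{\Downarrow}_r)=(x_r;\mathsf{var}_r)$.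 For each non-root node $v$, in order from smallest to largest depth, with $p=\mathrm{parent}(v)$: set $z^{\downarrow}_v=z^{\Downarrow}_p-\sum_{u\in\mathrm{child}(p)\setminus\{v\}}z^{\Uparrow}_u$, $\mathsf{var}^{\downarrow}_v=\mathsf{var}^{\Downarrow}_p+\sum_{u\in\mathrm{child}(p)\setminus\{v\}}\mathsf{var}^{\Uparrow}_u$; then $(\widehat{x}_v;\widehat{\mathsf{var}}_v)=\mathsf{CombineEstimates}((z^{\Uparrow}_v;\mathsf{var}^{\Uparrow}_v),(z^{\downarrow}_v;\mathsf{var}^{\downarrow}_v))$ and $(z^{\Downarrow}_v;\mathsf{var}^{\Downarrow}_v)=\mathsf{CombineEstimates}((x_v;\mathsf{var}_v),(z^{\downarrow}_v;\mathsf{var}^{\downarrow}_v))$. The output is $(\widehat{x}_v;\widehat{\mathsf{var}}_v)_{v\in T}$. *)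

theory Defs
  imports "HOL-Probability.Probability"
begin

definition combine_estimates :: "real \<times> real \<Rightarrow> real \<times> real \<Rightarrow> real \<times> real" where
  "combine_estimates = (\<lambda>(x, a) (y, b).
     let s = a * b / (a + b); z = s * (x / a + y / b) in (z, s))"

text \<open>
  A finite rooted tree is given by its node set, its root and its parent map. The value of
  \<open>parent\<close> at the root (and outside \<open>T\<close>) is irrelevant: it is never used below.
\<close>

locale finite_rooted_tree =
  fixes T :: "'v set" and r :: 'v and parent :: "'v \<Rightarrow> 'v"
  assumes finite_nodes: "finite T"
    and root_in: "r \<in> T"
    and parent_in: "v \<in> T \<Longrightarrow> v \<noteq> r \<Longrightarrow> parent v \<in> T"
    and reaches_root: "v \<in> T \<Longrightarrow> \<exists>n. (parent ^^ n) v = r"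
begin

definition child :: "'v \<Rightarrow> 'v set" where
  "child v = {u \<in> T - {r}. parent u = v}"

definition depth :: "'v \<Rightarrow> nat" where
  "depth v = (LEAST n. (parent ^^ n) v = r)"

lemma depth_parent:
  assumes "v \<in> T" "v \<noteq> r"
  shows "depth v = Suc (depth (parent v))"
proof -
  obtain n where "(parent ^^ n) v = r"
    using reaches_root[OF assms(1)] by blast
  then show ?thesis
    unfolding depth_def using assms(2)
    by (subst Least_Suc[of _ n]) (auto simp: funpow_swap1)
qed

lemma depth_child: "u \<in> child v \<Longrightarrow> depth u = Suc (depth v)"
  using depth_parent by (auto simp: child_def)

text \<open>
  The bottom-up pass. The recursion replaces the processing of the nodes by decreasing depth.
  Estimates are pairs of a value and a variance; \<open>x\<close> are the values of the observations and
  \<open>var\<close> their variances.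
\<close>

function up_estimate :: "('v \<Rightarrow> real) \<Rightarrow> ('v \<Rightarrow> real) \<Rightarrow> 'v \<Rightarrow> real \<times> real" where
  "up_estimate x var v =
     (if child v = {} then (x v, var v)
      else combine_estimates (x v, var v)
             (\<Sum>u\<in>child v. fst (up_estimate x var u),
              \<Sum>u\<in>child v. snd (up_estimate x var u)))"
  by pat_completeness auto
termination
proof (relation "Wellfounded.measure (\<lambda>(x, var, v). Max (depth ` T) - depth v)", goal_cases)
  case 1
  show ?case by simp
next
  have *: "Max (depth ` T) - depth u < Max (depth ` T) - depth v" if "u \<in> child v" for u v
  proof -
    have "depth u \<le> Max (depth ` T)"
      using that finite_nodes by (intro Max_ge) (auto simp: child_def)
    with depth_child[OF that] show ?thesis by simp
  qed
  {
    case (2 x var v u)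
    then show ?case using * by simp
  next
    case (3 x var v u)
    then show ?case using * by simp
  }
qed

text \<open>
  The estimate of a non-root node \<open>v\<close> obtained from the double-down estimate \<open>D\<close> of its parent
  and the bottom-up estimates of its siblings.
\<close>

definition from_above ::
    "('v \<Rightarrow> real) \<Rightarrow> ('v \<Rightarrow> real) \<Rightarrow> 'v \<Rightarrow> real \<times> real \<Rightarrow> real \<times> real" where
  "from_above x var v D =
     (fst D - (\<Sum>u\<in>child (parent v) - {v}. fst (up_estimate x var u)),
      snd D + (\<Sum>u\<in>child (parent v) - {v}. snd (up_estimate x var u)))"

text \<open>
  The double-down estimates of the top-down pass. The value at \<open>v \<notin> T\<close> is a dummy.
\<close>

function down_estimate :: "('v \<Rightarrow> real) \<Rightarrow> ('v \<Rightarrow> real) \<Rightarrow> 'v \<Rightarrow> real \<times> real" where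
  "down_estimate x var v =
     (if v = r \<or> v \<notin> T then (x v, var v)
      else combine_estimates (x v, var v)
             (from_above x var v (down_estimate x var (parent v))))"
  by pat_completeness auto
termination
  by (relation "Wellfounded.measure (\<lambda>(x, var, v). depth v)") (auto simp: depth_parent)

declare up_estimate.simps [simp del] down_estimate.simps [simp del]

definition tree_post_processing ::
    "('v \<Rightarrow> real) \<Rightarrow> ('v \<Rightarrow> real) \<Rightarrow> 'v \<Rightarrow> real \<times> real" where
  "tree_post_processing x var v =
     (if v = r then up_estimate x var r
      else combine_estimates (up_estimate x var v)
             (from_above x var v (down_estimate x var (parent v))))"

definition post_processed_estimator :: "('v \<Rightarrow> real) \<Rightarrow> 'v \<Rightarrow> ('v \<Rightarrow> real) \<Rightarrow> real" where
  "post_processed_estimator var v = (\<lambda>x. fst (tree_post_processing x var v))"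

definition consistent_counts :: "('v \<Rightarrow> real) \<Rightarrow> bool" where
  "consistent_counts c \<longleftrightarrow> (\<forall>v\<in>T. child v \<noteq> {} \<longrightarrow> c v = (\<Sum>u\<in>child v. c u))"

definition observations ::
    "('v \<Rightarrow> real) \<Rightarrow> ('v \<Rightarrow> real) \<Rightarrow> 'w measure \<Rightarrow> ('v \<Rightarrow> 'w \<Rightarrow> real) \<Rightarrow> bool" where
  "observations c var M X \<longleftrightarrow>
     prob_space M \<and> prob_space.indep_vars M (\<lambda>_. borel) X T \<and>
     (\<forall>v\<in>T. integrable M (X v) \<and> integrable M (\<lambda>\<omega>. (X v \<omega>)\<^sup>2) \<and>
        prob_space.expectation M (X v) = c v \<and> prob_space.variance M (X v) = var v)"

text \<open>
  An estimator is a function of the vector of observed values. Its unbiasedness refers to all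
  choices of consistent counts, not only to the true ones: for each choice \<open>c\<close>, the expectation
  is taken under any joint law \<open>P\<close> on \<open>\<real>\<^sup>T\<close> of the observations (given by the coordinate
  functions) that is admissible for the counts \<open>c\<close> and the
  known variances.
\<close>

definition linear_estimator :: "(('v \<Rightarrow> real) \<Rightarrow> real) \<Rightarrow> bool" where
  "linear_estimator f \<longleftrightarrow> (\<exists>a. \<forall>x. f x = (\<Sum>u\<in>T. a u * x u))"

definition unbiased_estimator ::
    "('v \<Rightarrow> real) \<Rightarrow> 'v \<Rightarrow> (('v \<Rightarrow> real) \<Rightarrow> real) \<Rightarrow> bool" where
  "unbiased_estimator var v f \<longleftrightarrow>
     (\<forall>c P. consistent_counts c \<longrightarrow>
        sets P = sets (\<Pi>\<^sub>M u\<in>T. (borel :: real measure)) \<longrightarrow>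
        observations c var P (\<lambda>u x. x u) \<longrightarrow>
        prob_space.expectation P f = c v)"

definition linear_unbiased_estimator ::
    "('v \<Rightarrow> real) \<Rightarrow> 'v \<Rightarrow> (('v \<Rightarrow> real) \<Rightarrow> real) \<Rightarrow> bool" where
  "linear_unbiased_estimator var v f \<longleftrightarrow> linear_estimator f \<and> unbiased_estimator var v f"

definition is_BLUE ::
    "('v \<Rightarrow> real) \<Rightarrow> 'w measure \<Rightarrow> ('v \<Rightarrow> 'w \<Rightarrow> real) \<Rightarrow> 'v \<Rightarrow> (('v \<Rightarrow> real) \<Rightarrow> real) \<Rightarrow> bool" where
  "is_BLUE var M X v f \<longleftrightarrow>
     linear_unbiased_estimator var v f \<and>
     (\<forall>g. linear_unbiased_estimator var v g \<longrightarrow>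
        prob_space.variance M (\<lambda>\<omega>. f (\<lambda>u. X u \<omega>)) \<le> prob_space.variance M (\<lambda>\<omega>. g (\<lambda>u. X u \<omega>)))"

end

definition RMSRE :: "'w measure \<Rightarrow> real \<Rightarrow> real \<Rightarrow> ('w \<Rightarrow> real) \<Rightarrow> real" where
  "RMSRE M \<tau> c Z = sqrt (prob_space.expectation M (\<lambda>\<omega>. (\<bar>Z \<omega> - c\<bar> / max \<tau> c)\<^sup>2))"

end

theory Submission
  imports Defs
begin

text \<open>
  The variances carried by the two passes do not depend on the observed values, so the estimator
  of each node is a linear form \<open>\<Sum>u. a u * x u\<close>; it is unbiased because both passes reproduce
  consistent counts. For an internal node \<open>w\<close>, feed the procedure the input with value \<open>var w\<close>
  at \<open>w\<close>, \<open>- var u\<close> at each child \<open>u\<close> of \<open>w\<close>, and 0 elsewhere. The values at the children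
  are then cancelled against the value at \<open>w\<close> in each combination, so every output is 0. This
  says that the rescaled coefficients \<open>a u * var u\<close> are themselves consistent counts, hence they
  are orthogonal to the coefficients of every linear unbiased estimator of zero, and the variance
  of any linear unbiased estimator exceeds that of the output by a sum of squares.
  The same consistency gives the variance \<open>\<Sum>u. (a u)\<^sup>2 * var u = a v * var v\<close>, which is
  the output on the input supported at \<open>v\<close> alone and is read off along the path to the root.
\<close>

section \<open>Linear combinations of independent random variables\<close>

text \<open>After centring, the variance is the expectation of a squared sum. Independence
  factorises each off-diagonal expectation into a product of means, which are 0, so only the
  diagonal survives.\<close>

lemma (in prob_space) variance_linear_combination_indep:
  fixes X :: "'i \<Rightarrow> 'a \<Rightarrow> real"
  assumes "finite I" and indep: "indep_vars (\<lambda>_. borel) X I"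
    and int: "\<And>i. i \<in> I \<Longrightarrow> integrable M (X i)"
    and int2: "\<And>i. i \<in> I \<Longrightarrow> integrable M (\<lambda>\<omega>. (X i \<omega>)\<^sup>2)"
  shows "variance (\<lambda>\<omega>. \<Sum>i\<in>I. a i * X i \<omega>) = (\<Sum>i\<in>I. (a i)\<^sup>2 * variance (X i))"
proof -
  define Y where "Y i \<omega> = X i \<omega> - expectation (X i)" for i \<omega>
  have Y_indep: "indep_vars (\<lambda>_. borel) Y I"
    unfolding Y_def by (rule indep_vars_compose2[OF indep]) simp
  have Y_int: "integrable M (Y i)" if "i \<in> I" for i
    unfolding Y_def using int[OF that] by simp
  have Y_int2: "integrable M (\<lambda>\<omega>. Y i \<omega> * Y i \<omega>)" if "i \<in> I" for i
  proof -
    have "integrable M (\<lambda>\<omega>. (X i \<omega>)\<^sup>2 - 2 * expectation (X i) * X i \<omega> + (expectation (X i))\<^sup>2)"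
      using int[OF that] int2[OF that] by simp
    then show ?thesis
      by (simp add: Y_def power2_eq_square algebra_simps)
  qed
  have Y_cross: "integrable M (\<lambda>\<omega>. Y i \<omega> * Y j \<omega>) \<and> expectation (\<lambda>\<omega>. Y i \<omega> * Y j \<omega>) = 0"
    if "i \<in> I" "j \<in> I" "i \<noteq> j" for i j
  proof -
    have "indep_vars (\<lambda>_. borel) Y {i, j}"
      using that by (intro indep_vars_subset[OF Y_indep]) auto
    from indep_vars_integrable[OF _ this] indep_vars_lebesgue_integral[OF _ this]
    have "integrable M (\<lambda>\<omega>. Y i \<omega> * Y j \<omega>)"
      "expectation (\<lambda>\<omega>. Y i \<omega> * Y j \<omega>) = expectation (Y i) * expectation (Y j)"
      using that Y_int by auto
    moreover have "expectation (Y i) = 0"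
      unfolding Y_def using int[OF that(1)] by (simp add: prob_space)
    ultimately show ?thesis by simp
  qed
  have YY_int: "integrable M (\<lambda>\<omega>. Y i \<omega> * Y j \<omega>)" if "i \<in> I" "j \<in> I" for i j
    using that Y_int2 Y_cross by (cases "i = j") auto
  have "variance (\<lambda>\<omega>. \<Sum>i\<in>I. a i * X i \<omega>) = expectation (\<lambda>\<omega>. (\<Sum>i\<in>I. a i * Y i \<omega>)\<^sup>2)"
    using int by (simp add: Y_def right_diff_distrib sum_subtractf)
  also have "\<dots> = expectation (\<lambda>\<omega>. \<Sum>i\<in>I. \<Sum>j\<in>I. a i * a j * (Y i \<omega> * Y j \<omega>))"
    by (simp add: power2_eq_square sum_product mult_ac)
  also have "\<dots> = (\<Sum>i\<in>I. \<Sum>j\<in>I. a i * a j * expectation (\<lambda>\<omega>. Y i \<omega> * Y j \<omega>))"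
    using YY_int by (subst Bochner_Integration.integral_sum; simp)
  also have "\<dots> = (\<Sum>i\<in>I. \<Sum>j\<in>I. if j = i then (a i)\<^sup>2 * variance (X i) else 0)"
    using Y_cross by (intro sum.cong refl) (auto simp: Y_def power2_eq_square)
  also have "\<dots> = (\<Sum>i\<in>I. (a i)\<^sup>2 * variance (X i))"
    using \<open>finite I\<close> by simp
  finally show ?thesis .
qed

section \<open>Algebra of combining two estimates\<close>

lemma combine_estimates_eq:
  "combine_estimates (x, a) (y, b) = ((a * b / (a + b)) * (x / a + y / b), a * b / (a + b))"
  by (simp add: combine_estimates_def Let_def)

lemma fst_combine_estimates:
  "fst (combine_estimates p q) =
     (snd p * snd q / (snd p + snd q)) * (fst p / snd p + fst q / snd q)"
  by (cases p; cases q) (simp add: combine_estimates_eq)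

lemma snd_combine_estimates:
  "snd (combine_estimates p q) = snd p * snd q / (snd p + snd q)"
  by (cases p; cases q) (simp add: combine_estimates_eq)

text \<open>The combination is a weighted average whose weights sum to 1. This is what makes both
  passes reproduce consistent counts.\<close>

lemma fst_combine_estimates_same:
  assumes "fst p = x" "fst q = x" "0 < snd p" "0 < snd q"
  shows "fst (combine_estimates p q) = x"
  using assms by (simp add: fst_combine_estimates divide_simps) (simp add: algebra_simps)

text \<open>The two quotients of value by variance are 1 and -1, so they cancel whatever the
  variances are.\<close>

lemma fst_combine_estimates_cancel:
  assumes "fst p = snd p" "fst q = - snd q" "0 < snd p" "0 < snd q"
  shows "fst (combine_estimates p q) = 0"
  using assms by (simp add: fst_combine_estimates)

section \<open>Induction along the tree and unfolding of the two passes\<close>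

context finite_rooted_tree
begin

lemma child_finite [simp]: "finite (child v)"
  using finite_nodes by (simp add: child_def)

lemma child_subset: "child v \<subseteq> T"
  by (auto simp: child_def)

lemma child_in: "u \<in> child v \<Longrightarrow> u \<in> T"
  by (simp add: child_def)

lemma parent_child: "u \<in> child v \<Longrightarrow> parent u = v"
  by (simp add: child_def)

lemma mem_child_parent: "v \<in> T \<Longrightarrow> v \<noteq> r \<Longrightarrow> v \<in> child (parent v)"
  by (simp add: child_def)

lemma not_mem_child_self: "v \<notin> child v"
  using depth_child[of v v] by auto

text \<open>The distance of a node from the deepest level drops when passing to a child; it is the
  measure that also justifies the recursion of \<open>up_estimate\<close>.\<close>

lemma up_induct [consumes 1, case_names node]:
  assumes "v \<in> T" and step: "\<And>v. v \<in> T \<Longrightarrow> (\<And>u. u \<in> child v \<Longrightarrow> P u) \<Longrightarrow> P v"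
  shows "P v"
proof -
  have bound: "depth u \<le> Max (depth ` T)" if "u \<in> T" for u
    using that finite_nodes by (intro Max_ge) auto
  from \<open>v \<in> T\<close> show ?thesis
  proof (induction "Max (depth ` T) - depth v" arbitrary: v rule: less_induct)
    case less
    show ?case
    proof (rule step[OF less.prems])
      fix u assume u: "u \<in> child v"
      then have "u \<in> T" using child_subset by auto
      moreover have "Max (depth ` T) - depth u < Max (depth ` T) - depth v"
        using depth_child[OF u] bound[OF \<open>u \<in> T\<close>] by simp
      ultimately show "P u" by (rule less.hyps[rotated])
    qed
  qed
qed

lemma down_induct [consumes 1, case_names root node]:
  assumes "v \<in> T" and "P r" and step: "\<And>v. v \<in> T \<Longrightarrow> v \<noteq> r \<Longrightarrow> P (parent v) \<Longrightarrow> P v"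
  shows "P v"
  using \<open>v \<in> T\<close>
proof (induction "depth v" arbitrary: v rule: less_induct)
  case less
  show ?case
  proof (cases "v = r")
    case False
    show ?thesis
    proof (rule step[OF less.prems False])
      show "P (parent v)"
        using depth_parent[OF less.prems False]
        by (intro less.hyps parent_in[OF less.prems False]) simp
    qed
  qed (simp add: \<open>P r\<close>)
qed

lemma up_estimate_leaf: "child v = {} \<Longrightarrow> up_estimate x var v = (x v, var v)"
  by (simp add: up_estimate.simps)

lemma up_estimate_internal:
  "child v \<noteq> {} \<Longrightarrow> up_estimate x var v = combine_estimates (x v, var v)
     (\<Sum>u\<in>child v. fst (up_estimate x var u), \<Sum>u\<in>child v. snd (up_estimate x var u))"
  by (subst up_estimate.simps) simp

lemma down_estimate_root: "down_estimate x var r = (x r, var r)"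
  by (simp add: down_estimate.simps)

lemma down_estimate_node:
  "v \<in> T \<Longrightarrow> v \<noteq> r \<Longrightarrow> down_estimate x var v =
     combine_estimates (x v, var v) (from_above x var v (down_estimate x var (parent v)))"
  by (subst down_estimate.simps) simp

section \<open>The variances\<close>

text \<open>The weights in each combination are functions of the variances alone. Their independence
  of the observed values is what makes the procedure linear.\<close>

lemma snd_up_estimate_indep: "v \<in> T \<Longrightarrow> snd (up_estimate x var v) = snd (up_estimate y var v)"
proof (induction v rule: up_induct)
  case (node v)
  then show ?case
    by (cases "child v = {}")
       (simp_all add: up_estimate_leaf up_estimate_internal snd_combine_estimates cong: sum.cong)
qed

lemma snd_from_above_indep:
  assumes "snd D = snd D'"
  shows "snd (from_above x var v D) = snd (from_above y var v D')"
  unfolding from_above_def using assms child_subset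
  by (auto intro!: sum.cong snd_up_estimate_indep)

lemma snd_down_estimate_indep:
  "v \<in> T \<Longrightarrow> snd (down_estimate x var v) = snd (down_estimate y var v)"
proof (induction v rule: down_induct)
  case (node v)
  then show ?case
    using snd_from_above_indep[OF node.IH, where x = x and y = y and v = v and var = var]
    by (simp add: down_estimate_node snd_combine_estimates)
qed (simp add: down_estimate_root)

lemma snd_tree_post_processing_indep:
  assumes "v \<in> T"
  shows "snd (tree_post_processing x var v) = snd (tree_post_processing y var v)"
  using snd_up_estimate_indep[OF assms]
    snd_from_above_indep[OF snd_down_estimate_indep[OF parent_in[OF assms]]]
  by (simp add: tree_post_processing_def snd_combine_estimates)
     (metis snd_up_estimate_indep assms)

section \<open>Linearity\<close>

lemma linear_estimator_component: "v \<in> T \<Longrightarrow> linear_estimator (\<lambda>x. x v)"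
  unfolding linear_estimator_def
  by (rule exI[of _ "\<lambda>u. if u = v then 1 else 0"])
     (simp add: finite_nodes if_distrib[of "\<lambda>a. a * _"] cong: if_cong)

lemma linear_estimator_add:
  assumes "linear_estimator f" "linear_estimator g"
  shows "linear_estimator (\<lambda>x. f x + g x)"
proof -
  from assms obtain a b where "\<And>x. f x = (\<Sum>u\<in>T. a u * x u)" "\<And>x. g x = (\<Sum>u\<in>T. b u * x u)"
    unfolding linear_estimator_def by blast
  then show ?thesis
    unfolding linear_estimator_def
    by (intro exI[of _ "\<lambda>u. a u + b u"]) (simp add: sum.distrib distrib_right)
qed

lemma linear_estimator_scale:
  assumes "linear_estimator f"
  shows "linear_estimator (\<lambda>x. k * f x)"
proof -
  from assms obtain a where "\<And>x. f x = (\<Sum>u\<in>T. a u * x u)"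
    unfolding linear_estimator_def by blast
  then show ?thesis
    unfolding linear_estimator_def
    by (intro exI[of _ "\<lambda>u. k * a u"]) (simp add: sum_distrib_left mult.assoc)
qed

lemma linear_estimator_zero: "linear_estimator (\<lambda>x. 0)"
  unfolding linear_estimator_def by (rule exI[of _ "\<lambda>_. 0"]) simp

lemma linear_estimator_diff:
  "linear_estimator f \<Longrightarrow> linear_estimator g \<Longrightarrow> linear_estimator (\<lambda>x. f x - g x)"
  using linear_estimator_add[OF _ linear_estimator_scale[of g "-1"], of f] by simp

lemma linear_estimator_sum:
  "(\<And>i. i \<in> I \<Longrightarrow> linear_estimator (f i)) \<Longrightarrow> linear_estimator (\<lambda>x. \<Sum>i\<in>I. f i x)"
  by (induction I rule: infinite_finite_induct)
     (simp_all add: linear_estimator_zero linear_estimator_add)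

text \<open>The input \<open>y\<close> is only a reference point: since the variances of
  \<open>p\<close> and \<open>q\<close> are the same at every input, their values at
  \<open>y\<close> serve as the constant weights of a fixed linear combination.\<close>

lemma linear_estimator_combine:
  assumes "linear_estimator (\<lambda>x. fst (p x))" "linear_estimator (\<lambda>x. fst (q x))"
    and "\<And>x. snd (p x) = snd (p y)" "\<And>x. snd (q x) = snd (q y)"
  shows "linear_estimator (\<lambda>x. fst (combine_estimates (p x) (q x)))"
proof -
  let ?a = "snd (p y)" and ?b = "snd (q y)"
  have "(\<lambda>x. fst (combine_estimates (p x) (q x))) =
      (\<lambda>x. ?a * ?b / (?a + ?b) * (1 / ?a * fst (p x) + 1 / ?b * fst (q x)))"
  proof
    show "fst (combine_estimates (p x) (q x)) =
      ?a * ?b / (?a + ?b) * (1 / ?a * fst (p x) + 1 / ?b * fst (q x))" for x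
      using assms(3)[of x] assms(4)[of x] by (simp add: fst_combine_estimates)
  qed
  then show ?thesis
    by (simp only:) (intro linear_estimator_scale linear_estimator_add assms)
qed

lemma linear_up_estimate: "v \<in> T \<Longrightarrow> linear_estimator (\<lambda>x. fst (up_estimate x var v))"
proof (induction v rule: up_induct)
  case (node v)
  show ?case
  proof (cases "child v = {}")
    case True
    then show ?thesis using node.hyps by (simp add: up_estimate_leaf linear_estimator_component)
  next
    case False
    have "snd (up_estimate x var u) = snd (up_estimate y var u)" if "u \<in> child v" for x y u
      using that child_subset by (intro snd_up_estimate_indep) auto
    then have "linear_estimator (\<lambda>x. fst (combine_estimates (x v, var v)
        (\<Sum>u\<in>child v. fst (up_estimate x var u), \<Sum>u\<in>child v. snd (up_estimate x var u))))"
      using node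
      by (intro linear_estimator_combine[where y = "\<lambda>_. 0"])
         (auto intro!: linear_estimator_component linear_estimator_sum sum.cong)
    with False show ?thesis by (simp add: up_estimate_internal)
  qed
qed

lemma linear_from_above:
  assumes "linear_estimator (\<lambda>x. fst (D x))"
  shows "linear_estimator (\<lambda>x. fst (from_above x var v (D x)))"
  unfolding from_above_def fst_conv using assms child_subset
  by (intro linear_estimator_diff linear_estimator_sum linear_up_estimate) auto

lemma linear_down_estimate: "v \<in> T \<Longrightarrow> linear_estimator (\<lambda>x. fst (down_estimate x var v))"
proof (induction v rule: down_induct)
  case root
  show ?case by (simp add: down_estimate_root linear_estimator_component root_in)
next
  case (node v)
  have "linear_estimator (\<lambda>x. fst (combine_estimates (x v, var v)
      (from_above x var v (down_estimate x var (parent v)))))"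
    using node
    by (intro linear_estimator_combine[where y = "\<lambda>_. 0"] linear_from_above snd_from_above_indep
        snd_down_estimate_indep parent_in)
       (simp_all add: linear_estimator_component)
  with node.hyps show ?case by (simp add: down_estimate_node)
qed

lemma linear_post_processed:
  assumes "v \<in> T"
  shows "linear_estimator (post_processed_estimator var v)"
proof (cases "v = r")
  case True
  then show ?thesis
    using assms
    by (simp add: post_processed_estimator_def tree_post_processing_def linear_up_estimate)
next
  case False
  have "linear_estimator (\<lambda>x. fst (combine_estimates (up_estimate x var v)
      (from_above x var v (down_estimate x var (parent v)))))"
    using assms False
    by (intro linear_estimator_combine[where y = "\<lambda>_. 0"] linear_from_above snd_from_above_indep
        snd_up_estimate_indep snd_down_estimate_indep linear_up_estimate linear_down_estimate
        parent_in) simp_all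
  with False show ?thesis
    by (simp add: post_processed_estimator_def tree_post_processing_def)
qed

section \<open>Moments of linear estimators\<close>

lemma linear_estimator_expectation:
  assumes obs: "observations c var M X" and "linear_estimator f"
  shows "prob_space.expectation M (\<lambda>\<omega>. f (\<lambda>u. X u \<omega>)) = f c"
proof -
  interpret prob_space M using obs by (simp add: observations_def)
  from \<open>linear_estimator f\<close> obtain a where f: "\<And>x. f x = (\<Sum>u\<in>T. a u * x u)"
    unfolding linear_estimator_def by blast
  have "integrable M (X u)" "expectation (X u) = c u" if "u \<in> T" for u
    using obs that by (auto simp: observations_def)
  then show ?thesis
    by (simp add: f)
qed

lemma linear_combination_variance:
  assumes obs: "observations c var M X"
  shows "prob_space.variance M (\<lambda>\<omega>. \<Sum>u\<in>T. a u * X u \<omega>) = (\<Sum>u\<in>T. (a u)\<^sup>2 * var u)"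
proof -
  interpret prob_space M using obs by (simp add: observations_def)
  have "variance (\<lambda>\<omega>. \<Sum>u\<in>T. a u * X u \<omega>) = (\<Sum>u\<in>T. (a u)\<^sup>2 * variance (X u))"
    using obs by (intro variance_linear_combination_indep finite_nodes) (simp_all add: observations_def)
  also have "\<dots> = (\<Sum>u\<in>T. (a u)\<^sup>2 * var u)"
    using obs by (intro sum.cong refl) (auto simp: observations_def)
  finally show ?thesis .
qed

text \<open>Unbiasedness quantifies over all admissible laws, so extracting information from it at
  counts \<open>c\<close> requires at least one such law. A product of normal distributions with
  means \<open>c u\<close> and variances \<open>var u\<close> provides it.\<close>

lemma observations_exist:
  assumes var_pos: "\<And>v. v \<in> T \<Longrightarrow> 0 < var v"
  obtains P where "sets P = sets (\<Pi>\<^sub>M u\<in>T. (borel :: real measure))"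
    "observations c var P (\<lambda>u x. x u)"
proof -
  define N where "N u = density lborel (\<lambda>x. ennreal (normal_density (c u) (sqrt (var u)) x))" for u
  define P where "P = (\<Pi>\<^sub>M u\<in>T. N u)"
  have N_prob: "prob_space (N u)" if "u \<in> T" for u
    unfolding N_def using var_pos[OF that] by (intro prob_space_normal_density) simp
  have N_sets [measurable_cong]: "sets (N u) = sets borel" for u
    by (simp add: N_def)
  interpret P: prob_space P
    unfolding P_def by (intro prob_space_PiM N_prob)
  have sets_P: "sets P = sets (\<Pi>\<^sub>M u\<in>T. (borel :: real measure))"
    unfolding P_def by (intro sets_PiM_cong refl N_sets)
  have meas [measurable]: "(\<lambda>x. x u) \<in> borel_measurable P" if "u \<in> T" for u
    unfolding measurable_cong_sets[OF sets_P refl] using that by simp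
  have distr: "distr P borel (\<lambda>x. x u) = N u" if "u \<in> T" for u
  proof -
    have "distr P borel (\<lambda>x. x u) = distr P (N u) (\<lambda>x. x u)"
      by (intro distr_cong) (simp_all add: N_sets)
    also have "\<dots> = N u"
      unfolding P_def by (intro distr_PiM_component N_prob that)
    finally show ?thesis .
  qed
  have "P.indep_vars (\<lambda>_. borel) (\<lambda>u x. x u) T"
  proof (subst P.indep_vars_iff_distr_eq_PiM')
    show "T \<noteq> {}" using root_in by auto
    show "(\<lambda>x. x u) \<in> borel_measurable P" if "u \<in> T" for u using that by (rule meas)
    \<comment> \<open>Points of the product space are extensional on \<open>T\<close>, so
      restriction to \<open>T\<close> is the identity there and the joint law is \<open>P\<close>
      itself, the product of its marginals.\<close>
    have "distr P (\<Pi>\<^sub>M u\<in>T. borel) (\<lambda>x. \<lambda>u\<in>T. x u) = distr P P (\<lambda>x. x)"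
      by (intro distr_cong refl sets_P[symmetric])
         (simp add: P_def space_PiM PiE_def extensional_restrict)
    also have "\<dots> = (\<Pi>\<^sub>M u\<in>T. distr P borel (\<lambda>x. x u))"
      by (simp add: distr_id P_def[symmetric] distr cong: PiM_cong)
    finally show "distr P (\<Pi>\<^sub>M u\<in>T. borel) (\<lambda>x. \<lambda>u\<in>T. x u)
      = (\<Pi>\<^sub>M u\<in>T. distr P borel (\<lambda>x. x u))" .
  qed
  moreover have "integrable P (\<lambda>x. x u) \<and> integrable P (\<lambda>x. (x u)\<^sup>2) \<and>
      P.expectation (\<lambda>x. x u) = c u \<and> P.variance (\<lambda>x. x u) = var u" if u: "u \<in> T" for u
  proof -
    let ?n = "normal_density (c u) (sqrt (var u))"
    have s: "0 < sqrt (var u)" using var_pos[OF u] by simp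
    have dist: "distributed P lborel (\<lambda>x. x u) ?n"
      unfolding distributed_def using distr[OF u] meas[OF u]
      by (simp add: N_def cong: distr_cong)
    have int1: "integrable lborel (\<lambda>y. ?n y * y)"
      using s by (rule integrable_normal_moment_nz_1)
    \<comment> \<open>The raw second moment is recovered from the central one through
      \<open>y^2 = (y - c)^2 + 2 * c * y - c^2\<close>.\<close>
    have "integrable lborel (\<lambda>y. ?n y * (y - c u)\<^sup>2 + 2 * c u * (?n y * y) - (c u)\<^sup>2 * ?n y)"
      using s int1 by (intro Bochner_Integration.integrable_add Bochner_Integration.integrable_diff
          integrable_normal_moment integrable_mult_right integrable_normal_density) auto
    then have int2: "integrable lborel (\<lambda>y. ?n y * y\<^sup>2)"
      by (rule Bochner_Integration.integrable_cong[THEN iffD1, rotated 2])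
         (simp_all add: power2_eq_square algebra_simps)
    have "integrable P (\<lambda>x. x u)"
      using distributed_integrable[OF dist, of "\<lambda>y. y"] int1 by simp
    moreover have "integrable P (\<lambda>x. (x u)\<^sup>2)"
      using distributed_integrable[OF dist, of "\<lambda>y. y\<^sup>2"] int2 by simp
    ultimately show ?thesis
      using P.normal_distributed_expectation[OF s dist] P.normal_distributed_variance[OF s dist]
        var_pos[OF u] by simp
  qed
  ultimately have "observations c var P (\<lambda>u x. x u)"
    unfolding observations_def using P.prob_space_axioms by blast
  with sets_P show ?thesis by (rule that)
qed

end

section \<open>Positivity of the propagated variances\<close>

locale observed_tree = finite_rooted_tree T r parent
  for T :: "'v set" and r :: 'v and parent :: "'v \<Rightarrow> 'v" +
  fixes var :: "'v \<Rightarrow> real"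
  assumes var_pos: "v \<in> T \<Longrightarrow> 0 < var v"
begin

lemma up_estimate_var_pos: "v \<in> T \<Longrightarrow> 0 < snd (up_estimate x var v)"
proof (induction v rule: up_induct)
  case (node v)
  then show ?case
  proof (cases "child v = {}")
    case False
    then have "0 < (\<Sum>u\<in>child v. snd (up_estimate x var u))"
      using node.IH by (intro sum_pos) auto
    with False var_pos[OF node.hyps] show ?thesis
      by (simp add: up_estimate_internal snd_combine_estimates)
  qed (simp add: up_estimate_leaf var_pos)
qed

lemma from_above_var_pos: "0 < snd D \<Longrightarrow> 0 < snd (from_above x var v D)"
  unfolding from_above_def using child_subset
  by (auto intro!: add_pos_nonneg sum_nonneg less_imp_le[OF up_estimate_var_pos])

lemma down_estimate_var_pos: "v \<in> T \<Longrightarrow> 0 < snd (down_estimate x var v)"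
proof (induction v rule: down_induct)
  case root
  show ?case by (simp add: down_estimate_root var_pos root_in)
next
  case (node v)
  then show ?case
    using from_above_var_pos[OF node.IH, of x v] var_pos[OF node.hyps(1)]
    by (simp add: down_estimate_node snd_combine_estimates)
qed

lemma children_var_pos:
  "child v \<noteq> {} \<Longrightarrow> 0 < (\<Sum>u\<in>child v. snd (up_estimate x var u))"
  using child_subset by (intro sum_pos) (auto intro: up_estimate_var_pos)

section \<open>Unbiasedness\<close>

context
  fixes c :: "'v \<Rightarrow> real"
  assumes consistent: "consistent_counts c"
begin

text \<open>The consistent counts are themselves used as input: at an internal node the observation
  and the sum over the children then agree, and a combination of equal values is that value.\<close>

lemma up_estimate_consistent: "v \<in> T \<Longrightarrow> fst (up_estimate c var v) = c v"
proof (induction v rule: up_induct)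
  case (node v)
  then show ?case
  proof (cases "child v = {}")
    case False
    then have "c v = (\<Sum>u\<in>child v. c u)"
      using consistent node.hyps by (simp add: consistent_counts_def)
    then have "(\<Sum>u\<in>child v. fst (up_estimate c var u)) = c v"
      using node.IH by simp
    with False var_pos[OF node.hyps] children_var_pos[OF False] show ?thesis
      by (simp add: up_estimate_internal fst_combine_estimates_same)
  qed (simp add: up_estimate_leaf)
qed

lemma from_above_consistent:
  assumes "v \<in> T" "v \<noteq> r" "fst D = c (parent v)"
  shows "fst (from_above c var v D) = c v"
proof -
  have v: "v \<in> child (parent v)" using assms by (simp add: mem_child_parent)
  then have "c (parent v) = (\<Sum>u\<in>child (parent v). c u)"
    using consistent parent_in[OF assms(1,2)] by (auto simp: consistent_counts_def)
  also have "\<dots> = c v + (\<Sum>u\<in>child (parent v) - {v}. c u)"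
    using v by (simp add: sum.remove)
  also have "(\<Sum>u\<in>child (parent v) - {v}. c u)
      = (\<Sum>u\<in>child (parent v) - {v}. fst (up_estimate c var u))"
    by (intro sum.cong refl) (auto simp: up_estimate_consistent child_in)
  finally show ?thesis
    using assms by (simp add: from_above_def)
qed

lemma down_estimate_consistent: "v \<in> T \<Longrightarrow> fst (down_estimate c var v) = c v"
proof (induction v rule: down_induct)
  case (node v)
  then show ?case
    by (simp add: down_estimate_node fst_combine_estimates_same from_above_consistent
        from_above_var_pos down_estimate_var_pos parent_in var_pos)
qed (simp add: down_estimate_root)

lemma post_processed_consistent: "v \<in> T \<Longrightarrow> post_processed_estimator var v c = c v"
  by (cases "v = r")
     (simp_all add: post_processed_estimator_def tree_post_processing_def up_estimate_consistent
      fst_combine_estimates_same from_above_consistent down_estimate_consistent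
      from_above_var_pos down_estimate_var_pos up_estimate_var_pos parent_in)

end

section \<open>Orthogonality to the consistency relations\<close>

text \<open>This is the coefficient vector of the consistency relation at \<open>w\<close>,
  multiplied entrywise by the variances. Pairing it with coefficients \<open>a\<close> measures how
  far \<open>a u * var u\<close> is from satisfying that relation.\<close>

definition relation_input :: "'v \<Rightarrow> 'v \<Rightarrow> real" where
  "relation_input w u = (if u = w then var w else if u \<in> child w then - var u else 0)"

lemma relation_input_self: "relation_input w w = var w"
  by (simp add: relation_input_def)

lemma relation_input_child: "u \<in> child w \<Longrightarrow> relation_input w u = - var u"
  using not_mem_child_self by (auto simp: relation_input_def)

lemma relation_input_other: "u \<noteq> w \<Longrightarrow> u \<notin> child w \<Longrightarrow> relation_input w u = 0"
  by (simp add: relation_input_def)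

lemmas relation_input_simps = relation_input_self relation_input_child relation_input_other

text \<open>Below the children of \<open>w\<close> everything is 0, so at a child the quotient -1 is
  averaged with 0 and leaves minus the combined variance. At \<open>w\<close> the children sum to
  minus their total variance and cancel \<open>var w\<close>, so nothing travels further up.\<close>

lemma up_estimate_relation_input:
  assumes w: "child w \<noteq> {}"
  shows "v \<in> T \<Longrightarrow> fst (up_estimate (relation_input w) var v) =
    (if v \<in> child w then - snd (up_estimate (relation_input w) var v) else 0)"
proof (induction v rule: up_induct)
  case (node v)
  let ?y = "relation_input w"
  show ?case
  proof (cases "child v = {}")
    case True
    with w have "v \<noteq> w" by auto
    with True show ?thesis
      by (simp add: up_estimate_leaf relation_input_child relation_input_other)
  next
    case False
    note pos = var_pos[OF node.hyps] children_var_pos[OF False, of ?y]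
    show ?thesis
    proof (cases "v = w")
      case True
      then have "(\<Sum>u\<in>child v. fst (up_estimate ?y var u))
          = - (\<Sum>u\<in>child v. snd (up_estimate ?y var u))"
        using node.IH by (simp add: sum_negf)
      then show ?thesis
        using False pos True not_mem_child_self[of w]
        by (simp add: up_estimate_internal fst_combine_estimates_cancel relation_input_self)
    next
      case neq: False
      then have "u \<notin> child w" if "u \<in> child v" for u
        using that parent_child by blast
      then have "(\<Sum>u\<in>child v. fst (up_estimate ?y var u)) = 0"
        using node.IH by simp
      then show ?thesis
        using False pos neq
        by (cases "v \<in> child w")
           (auto simp: up_estimate_internal fst_combine_estimates snd_combine_estimates
            relation_input_simps)
    qed
  qed
qed

lemma siblings_relation_input:
  assumes "child w \<noteq> {}" "v \<in> T" "v \<noteq> r"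
  shows "(\<Sum>u\<in>child (parent v) - {v}. fst (up_estimate (relation_input w) var u)) =
    (if v \<in> child w
     then - (\<Sum>u\<in>child (parent v) - {v}. snd (up_estimate (relation_input w) var u)) else 0)"
proof -
  \<comment> \<open>Siblings share their parent, so either all of them are children of
    \<open>w\<close> or none is.\<close>
  have "u \<in> child w \<longleftrightarrow> v \<in> child w" if "u \<in> child (parent v)" for u
    using that assms by (auto simp: child_def)
  moreover have "u \<in> T" if "u \<in> child (parent v)" for u
    using that child_subset by auto
  ultimately show ?thesis
    using assms by (simp add: up_estimate_relation_input sum_negf)
qed

text \<open>For a child of \<open>w\<close>, subtracting sibling values that are minus their
  variances adds those variances to the value, exactly as \<open>from_above\<close> does to the
  variance component. Value and variance thus stay equal.\<close>

lemma from_above_relation_input: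
  assumes "child w \<noteq> {}" "v \<in> T" "v \<noteq> r" "fst D = (if v \<in> child w then snd D else 0)"
  shows "fst (from_above (relation_input w) var v D) =
    (if v \<in> child w then snd (from_above (relation_input w) var v D) else 0)"
  using assms siblings_relation_input[OF assms(1-3)] by (simp add: from_above_def)

text \<open>At \<open>w\<close> the quotient 1 of the observation meets 0 from above, leaving the
  combined variance. At a child of \<open>w\<close>, -1 from the observation meets +1 from above, so
  the signal ends there.\<close>

lemma down_estimate_relation_input:
  assumes w: "child w \<noteq> {}"
  shows "v \<in> T \<Longrightarrow> fst (down_estimate (relation_input w) var v) =
    (if v = w then snd (down_estimate (relation_input w) var v) else 0)"
proof (induction v rule: down_induct)
  case root
  have "r \<notin> child w" by (simp add: child_def)
  then show ?case
    unfolding down_estimate_root by (simp add: relation_input_def)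
next
  case (node v)
  let ?y = "relation_input w"
  let ?D = "down_estimate ?y var (parent v)"
  have mem: "v \<in> child w \<longleftrightarrow> parent v = w"
    using node.hyps by (auto simp: child_def)
  have eq: "fst (from_above ?y var v ?D) = (if v \<in> child w then snd (from_above ?y var v ?D) else 0)"
    using node.IH mem by (intro from_above_relation_input w node.hyps) auto
  have pos: "0 < var v" "0 < snd (from_above ?y var v ?D)"
    using node.hyps by (simp_all add: var_pos from_above_var_pos down_estimate_var_pos parent_in)
  show ?case
    using node.hyps eq pos not_mem_child_self[of w]
    by (cases "v \<in> child w"; cases "v = w")
       (auto simp: down_estimate_node fst_combine_estimates snd_combine_estimates
        relation_input_simps)
qed

text \<open>Only the children of \<open>w\<close> carry nonzero values, namely minus the variance
  from below and plus the variance from above; these cancel.\<close>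

lemma post_processed_relation_input:
  assumes w: "child w \<noteq> {}" and v: "v \<in> T"
  shows "post_processed_estimator var v (relation_input w) = 0"
proof (cases "v = r")
  case True
  then show ?thesis
    using up_estimate_relation_input[OF w v]
    by (simp add: post_processed_estimator_def tree_post_processing_def child_def)
next
  case False
  let ?y = "relation_input w"
  let ?D = "down_estimate ?y var (parent v)"
  have mem: "v \<in> child w \<longleftrightarrow> parent v = w"
    using v False by (auto simp: child_def)
  have "fst (from_above ?y var v ?D) = (if v \<in> child w then snd (from_above ?y var v ?D) else 0)"
    using down_estimate_relation_input[OF w parent_in[OF v False]] mem
    by (intro from_above_relation_input w v False) auto
  moreover have "0 < snd (up_estimate ?y var v)" "0 < snd (from_above ?y var v ?D)"
    using v False
    by (simp_all add: up_estimate_var_pos from_above_var_pos down_estimate_var_pos parent_in)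
  ultimately show ?thesis
    using up_estimate_relation_input[OF w v] False
    by (simp add: post_processed_estimator_def tree_post_processing_def fst_combine_estimates)
qed

section \<open>The weight of a node in its own estimate\<close>

text \<open>Ancestors include the node itself. The depths prescribe the number of steps to climb, so
  a node has at most one ancestor at each depth, and hence at most one among siblings.\<close>

definition ancestor :: "'v \<Rightarrow> 'v \<Rightarrow> bool" where
  "ancestor u v \<longleftrightarrow> depth u \<le> depth v \<and> (parent ^^ (depth v - depth u)) v = u"

lemma ancestor_refl: "ancestor v v"
  by (simp add: ancestor_def)

lemma ancestor_child:
  assumes "ancestor u v" "u \<in> child w"
  shows "ancestor w v"
proof -
  have "depth v - depth w = Suc (depth v - depth u)"
    using assms depth_child[OF assms(2)] by (auto simp: ancestor_def)
  then show ?thesis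
    using assms depth_child[OF assms(2)] parent_child by (auto simp: ancestor_def)
qed

lemma ancestor_siblings:
  assumes "ancestor u v" "ancestor u' v" "u \<in> child w" "u' \<in> child w"
  shows "u = u'"
  using assms depth_child by (auto simp: ancestor_def)

text \<open>The scaling by \<open>var v\<close> makes value and variance coincide at
  \<open>v\<close>, and makes the output at \<open>v\<close> equal to \<open>a v * var v\<close>
  when the output has coefficients \<open>a\<close>.\<close>

definition unit_input :: "'v \<Rightarrow> 'v \<Rightarrow> real" where
  "unit_input v u = (if u = v then var v else 0)"

lemma unit_input_self: "unit_input v v = var v"
  by (simp add: unit_input_def)

lemma unit_input_other: "u \<noteq> v \<Longrightarrow> unit_input v u = 0"
  by (simp add: unit_input_def)

text \<open>In the bottom-up pass the signal placed at \<open>v\<close> spreads only along the path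
  from \<open>v\<close> to the root.\<close>

lemma up_estimate_unit_input_not_ancestor:
  "u \<in> T \<Longrightarrow> \<not> ancestor u v \<Longrightarrow> fst (up_estimate (unit_input v) var u) = 0"
proof (induction u rule: up_induct)
  case (node u)
  have "(\<Sum>w\<in>child u. fst (up_estimate (unit_input v) var w)) = 0"
    using node ancestor_child by (intro sum.neutral) blast
  moreover have "u \<noteq> v"
    using node.prems ancestor_refl by auto
  ultimately show ?case
    by (cases "child u = {}")
       (simp_all add: up_estimate_leaf up_estimate_internal fst_combine_estimates unit_input_other)
qed

lemma siblings_unit_input:
  assumes "u \<in> child w" "ancestor u v"
  shows "(\<Sum>u'\<in>child w - {u}. fst (up_estimate (unit_input v) var u')) = 0"
proof (intro sum.neutral ballI up_estimate_unit_input_not_ancestor)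
  fix u' assume u': "u' \<in> child w - {u}"
  then show "u' \<in> T" by (auto dest: child_in)
  show "\<not> ancestor u' v"
    using ancestor_siblings[of u v u' w] u' assms by blast
qed

text \<open>At a strict ancestor of \<open>v\<close> the double-down estimate uses its own
  observation, the estimate of its parent and its siblings off the path; none of these sees the
  signal at \<open>v\<close>.\<close>

lemma down_estimate_unit_input:
  "u \<in> T \<Longrightarrow> ancestor u v \<Longrightarrow> u \<noteq> v \<Longrightarrow> fst (down_estimate (unit_input v) var u) = 0"
proof (induction u rule: down_induct)
  case root
  then show ?case by (simp add: down_estimate_root unit_input_other)
next
  case (node u)
  have u: "u \<in> child (parent u)"
    using node.hyps by (simp add: mem_child_parent)
  have "parent u \<noteq> v"
    using depth_child[OF u] node.prems by (auto simp: ancestor_def)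
  then have "fst (down_estimate (unit_input v) var (parent u)) = 0"
    using node.IH ancestor_child[OF node.prems(1) u] by simp
  then have "fst (from_above (unit_input v) var u (down_estimate (unit_input v) var (parent u))) = 0"
    using siblings_unit_input[OF u node.prems(1)] by (simp add: from_above_def)
  then show ?case
    using node.hyps node.prems
    by (simp add: down_estimate_node fst_combine_estimates unit_input_other)
qed

lemma up_estimate_unit_input:
  assumes "v \<in> T"
  shows "fst (up_estimate (unit_input v) var v) = snd (up_estimate (unit_input v) var v)"
proof -
  have "\<not> ancestor u v" if "u \<in> child v" for u
    using depth_child[OF that] by (simp add: ancestor_def)
  then have "(\<Sum>u\<in>child v. fst (up_estimate (unit_input v) var u)) = 0"
    by (intro sum.neutral ballI up_estimate_unit_input_not_ancestor) (auto dest: child_in)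
  then show ?thesis
    using var_pos[OF assms]
    by (cases "child v = {}")
       (simp_all add: up_estimate_leaf up_estimate_internal fst_combine_estimates
          snd_combine_estimates unit_input_self)
qed

text \<open>From below, value and variance at \<open>v\<close> are equal; from above the value is 0.
  Combining a quotient 1 with a quotient 0 gives the combined variance as value. The input
  \<open>x\<close> is arbitrary because the variance does not depend on it.\<close>

lemma post_processed_unit_input:
  assumes v: "v \<in> T"
  shows "post_processed_estimator var v (unit_input v) = snd (tree_post_processing x var v)"
proof -
  let ?e = "unit_input v"
  let ?D = "down_estimate ?e var (parent v)"
  have "fst (tree_post_processing ?e var v) = snd (tree_post_processing ?e var v)"
  proof (cases "v = r")
    case True
    then show ?thesis
      using up_estimate_unit_input[OF v] by (simp add: tree_post_processing_def)
  next
    case False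
    then have mem: "v \<in> child (parent v)" using v by (simp add: mem_child_parent)
    have "parent v \<noteq> v" using mem not_mem_child_self by metis
    then have "fst ?D = 0"
      using v False by (intro down_estimate_unit_input ancestor_child[OF ancestor_refl mem] parent_in)
    then have "fst (from_above ?e var v ?D) = 0"
      using siblings_unit_input[OF mem ancestor_refl] by (simp add: from_above_def)
    then show ?thesis
      using False up_estimate_unit_input[OF v] up_estimate_var_pos[OF v, of ?e]
      by (simp add: tree_post_processing_def fst_combine_estimates snd_combine_estimates)
  qed
  then show ?thesis
    using snd_tree_post_processing_indep[OF v, of ?e var x]
    by (simp add: post_processed_estimator_def)
qed

text \<open>The expectation of a linear estimator is its value at the vector of means, which turns
  unbiasedness into an algebraic condition on consistent counts. The forward direction relies on
  \<open>observations_exist\<close>.\<close>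

lemma unbiased_estimator_linear_iff:
  assumes f: "linear_estimator f"
  shows "unbiased_estimator var v f \<longleftrightarrow> (\<forall>c. consistent_counts c \<longrightarrow> f c = c v)"
proof
  assume unb: "unbiased_estimator var v f"
  show "\<forall>c. consistent_counts c \<longrightarrow> f c = c v"
  proof (intro allI impI)
    fix c assume c: "consistent_counts c"
    obtain P where P: "sets P = sets (\<Pi>\<^sub>M u\<in>T. (borel :: real measure))"
      "observations c var P (\<lambda>u x. x u)"
      using observations_exist[of var c] var_pos by blast
    then show "f c = c v"
      using unb c linear_estimator_expectation[OF P(2) f] by (simp add: unbiased_estimator_def)
  qed
next
  assume "\<forall>c. consistent_counts c \<longrightarrow> f c = c v"
  then show "unbiased_estimator var v f"
    unfolding unbiased_estimator_def by (auto dest: linear_estimator_expectation[OF _ f])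
qed

section \<open>Optimality\<close>

lemma rescaled_coefficients_consistent:
  assumes v: "v \<in> T"
    and a: "\<And>x. post_processed_estimator var v x = (\<Sum>u\<in>T. a u * x u)"
  shows "consistent_counts (\<lambda>u. a u * var u)"
  unfolding consistent_counts_def
proof (intro ballI impI)
  fix w assume w: "w \<in> T" "child w \<noteq> {}"
  have "0 = (\<Sum>u\<in>T. a u * relation_input w u)"
    using post_processed_relation_input[OF w(2) v] a by simp
  also have "\<dots> = (\<Sum>u\<in>T. (if u = w then a u * var u else 0)
      - (if u \<in> child w then a u * var u else 0))"
    using not_mem_child_self[of w]
    by (intro sum.cong refl) (auto simp: relation_input_def)
  also have "\<dots> = a w * var w - (\<Sum>u\<in>child w. a u * var u)"
    using w finite_nodes child_subset[of w]
    by (simp add: sum_subtractf sum.inter_restrict[symmetric] Int_absorb1)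
  finally show "a w * var w = (\<Sum>u\<in>child w. a u * var u)" by simp
qed

text \<open>The variance \<open>(a u)^2 * var u\<close>, summed over \<open>u\<close>, is the
  estimator applied to its own rescaled coefficients. These are consistent counts, so the estimator
  returns their entry at \<open>v\<close>, which \<open>unit_input\<close> reads off.\<close>

lemma post_processed_variance:
  assumes v: "v \<in> T"
    and obs: "observations c var M X"
  shows "prob_space.variance M (\<lambda>\<omega>. post_processed_estimator var v (\<lambda>u. X u \<omega>))
    = snd (tree_post_processing x var v)"
proof -
  obtain a where a: "\<And>x. post_processed_estimator var v x = (\<Sum>u\<in>T. a u * x u)"
    using linear_post_processed[OF v] unfolding linear_estimator_def by blast
  have "prob_space.variance M (\<lambda>\<omega>. post_processed_estimator var v (\<lambda>u. X u \<omega>))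
      = (\<Sum>u\<in>T. (a u)\<^sup>2 * var u)"
    unfolding a by (rule linear_combination_variance[OF obs])
  also have "\<dots> = post_processed_estimator var v (\<lambda>u. a u * var u)"
    by (simp add: a power2_eq_square mult.assoc)
  also have "\<dots> = a v * var v"
    using rescaled_coefficients_consistent[OF v a]
    by (intro post_processed_consistent v)
  also have "\<dots> = post_processed_estimator var v (unit_input v)"
    using v finite_nodes
    by (simp add: a unit_input_def if_distrib[of "\<lambda>y. _ * y"] cong: if_cong)
  also have "\<dots> = snd (tree_post_processing x var v)"
    by (rule post_processed_unit_input[OF v])
  finally show ?thesis .
qed

lemma post_processed_linear_unbiased:
  assumes v: "v \<in> T"
  shows "linear_unbiased_estimator var v (post_processed_estimator var v)"
  unfolding linear_unbiased_estimator_def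
  using unbiased_estimator_linear_iff[OF linear_post_processed[OF v]]
    linear_post_processed[OF v] post_processed_consistent[OF _ v] by auto

lemma post_processed_variance_minimal:
  assumes v: "v \<in> T"
    and obs: "observations c var M X" and g: "linear_unbiased_estimator var v g"
  shows "prob_space.variance M (\<lambda>\<omega>. post_processed_estimator var v (\<lambda>u. X u \<omega>))
    \<le> prob_space.variance M (\<lambda>\<omega>. g (\<lambda>u. X u \<omega>))"
proof -
  obtain a where a: "\<And>x. post_processed_estimator var v x = (\<Sum>u\<in>T. a u * x u)"
    using linear_post_processed[OF v] unfolding linear_estimator_def by blast
  obtain b where b: "\<And>x. g x = (\<Sum>u\<in>T. b u * x u)"
    using g unfolding linear_unbiased_estimator_def linear_estimator_def by blast
  let ?d = "\<lambda>u. a u * var u"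
  have d: "consistent_counts ?d"
    by (rule rescaled_coefficients_consistent[OF v a])
  \<comment> \<open>Both estimators are unbiased, hence both return the entry at \<open>v\<close> of
    the consistent vector \<open>?d\<close>; their difference annihilates it.\<close>
  have "g ?d = post_processed_estimator var v ?d"
    using d g unbiased_estimator_linear_iff[of g v]
      post_processed_consistent[OF d v]
    by (simp add: linear_unbiased_estimator_def)
  then have orth: "(\<Sum>u\<in>T. (b u - a u) * ?d u) = 0"
    by (simp add: a b left_diff_distrib sum_subtractf)
  have "0 \<le> (\<Sum>u\<in>T. (b u - a u)\<^sup>2 * var u)"
    using var_pos by (intro sum_nonneg) (simp add: less_imp_le)
  \<comment> \<open>This is \<open>(b - a)^2 = b^2 - a^2 - 2 * (b - a) * a\<close>, whose cross term
    sums to 0 by orthogonality.\<close>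
  also have "\<dots> = (\<Sum>u\<in>T. (b u)\<^sup>2 * var u - (a u)\<^sup>2 * var u - 2 * ((b u - a u) * ?d u))"
    by (intro sum.cong refl) (simp add: power2_eq_square algebra_simps)
  also have "\<dots> = (\<Sum>u\<in>T. (b u)\<^sup>2 * var u) - (\<Sum>u\<in>T. (a u)\<^sup>2 * var u)"
    using orth by (simp add: sum_subtractf flip: sum_distrib_left)
  finally show ?thesis
    unfolding a b linear_combination_variance[OF obs] by simp
qed

text \<open>The mean squared error of an unbiased estimator is its variance, and the denominator
  depends only on the threshold and the true count. Comparing errors therefore reduces to comparing
  variances.\<close>

lemma RMSRE_linear_unbiased:
  assumes c: "consistent_counts c"
    and obs: "observations c var M X" and g: "linear_unbiased_estimator var v g"
  shows "RMSRE M \<tau> (c v) (\<lambda>\<omega>. g (\<lambda>u. X u \<omega>)) =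
    sqrt (prob_space.variance M (\<lambda>\<omega>. g (\<lambda>u. X u \<omega>)) / (max \<tau> (c v))\<^sup>2)"
proof -
  have "g c = c v"
    using g c unbiased_estimator_linear_iff[of g v]
    by (simp add: linear_unbiased_estimator_def)
  then have "prob_space.expectation M (\<lambda>\<omega>. g (\<lambda>u. X u \<omega>)) = c v"
    using linear_estimator_expectation[OF obs, of g] g by (simp add: linear_unbiased_estimator_def)
  then show ?thesis
    by (simp add: RMSRE_def power_divide)
qed

end

theorem theorem4p1:
  fixes T :: "'v set" and r :: 'v and parent :: "'v \<Rightarrow> 'v"
    and c var :: "'v \<Rightarrow> real"
    and M :: "'w measure" and X :: "'v \<Rightarrow> 'w \<Rightarrow> real"
  assumes tree: "finite_rooted_tree T r parent"
    and counts: "finite_rooted_tree.consistent_counts T r parent c"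
    and var_pos: "\<And>v. v \<in> T \<Longrightarrow> 0 < var v"
    and obs: "finite_rooted_tree.observations T c var M X"
  shows "\<forall>v\<in>T.
      finite_rooted_tree.is_BLUE T r parent var M X v
        (finite_rooted_tree.post_processed_estimator T r parent var v) \<and>
      (\<forall>\<omega>\<in>space M. prob_space.variance M (\<lambda>\<omega>'. finite_rooted_tree.post_processed_estimator T r parent var v (\<lambda>u. X u \<omega>'))
         = snd (finite_rooted_tree.tree_post_processing T r parent (\<lambda>u. X u \<omega>) var v)) \<and>
      (\<forall>\<tau>>0. \<forall>g. finite_rooted_tree.linear_unbiased_estimator T r parent var v g \<longrightarrow>
         RMSRE M \<tau> (c v)
           (\<lambda>\<omega>. finite_rooted_tree.post_processed_estimator T r parent var v (\<lambda>u. X u \<omega>))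
         \<le> RMSRE M \<tau> (c v) (\<lambda>\<omega>. g (\<lambda>u. X u \<omega>)))"
proof -
  interpret finite_rooted_tree T r parent by (rule tree)
  interpret observed_tree T r parent var by unfold_locales (rule var_pos)
  show ?thesis
  proof (intro ballI conjI allI impI)
    fix v assume v: "v \<in> T"
    note lue = post_processed_linear_unbiased[OF v]
    note minimal = post_processed_variance_minimal[OF v obs]
    show "is_BLUE var M X v (post_processed_estimator var v)"
      unfolding is_BLUE_def using lue minimal by blast
    show "prob_space.variance M (\<lambda>\<omega>'. post_processed_estimator var v (\<lambda>u. X u \<omega>'))
        = snd (tree_post_processing (\<lambda>u. X u \<omega>) var v)" for \<omega>
      by (rule post_processed_variance[OF v obs])
    show "RMSRE M \<tau> (c v) (\<lambda>\<omega>. post_processed_estimator var v (\<lambda>u. X u \<omega>))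
        \<le> RMSRE M \<tau> (c v) (\<lambda>\<omega>. g (\<lambda>u. X u \<omega>))"
      if "0 < \<tau>" "linear_unbiased_estimator var v g" for \<tau> g
      unfolding RMSRE_linear_unbiased[OF counts obs lue]
        RMSRE_linear_unbiased[OF counts obs that(2)]
      using minimal[OF that(2)] by (intro real_sqrt_le_mono divide_right_mono) simp_all
  qed
qed

end
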